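(* Let $\Delta t>0$, $n\in\mathbb{N}$ with $n\ge1$, $a,b>-1$, and let $\tilde P_j^{(a,b),n}(t)=P_j^{(a,b)}(m_n(t))$ be the shifted Jacobi polynomial on the block $[(n-1)\Delta t,n\Delta t]$, where $m_n(t)=\frac{2t-(2n-1)\Delta t}{\Delta t}$. For any derivative order $r\ge0$ and any $j\ge 0$, $$\partial_t^r\tilde P_j^{(a,b),n}(n\Delta t)=\Delta t^{-r}\,(j+a+b+1)_r\binom{j+a}{j-r},$$ with the convention that the right-hand side is zero when $j<r$. Consequently, if $$u(t,\mathbf{x})=\sum_{j,\mathbf{k}}u_{j,\mathbf{k}}\,\tilde P_j^{(a,b),n}(t)\,q_{\mathbf{k}}(\mathbf{x}),$$ where $\{q_{\mathbf{k}}\}$ is a polynomial basis on a spatial domain $\Omega\subset\mathbb{R}^M$, then the $r$-th time derivative on the final slice is $$\partial_t^r u(n\Delta t,\mathbf{x})=\sum_{\mathbf{k}}\Bigl(\sum_j\Delta t^{-r}(j+a+b+1)_r\binom{j+a}{j-r}u_{j,\mathbf{k}}\Bigr)q_{\mathbf{k}}(\mathbf{x}).$$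
   Context: $P_j^{(a,b)}$ denotes the degree-$j$ Jacobi polynomial on $[-1,1]$ in the standard (DLMF) normalisation. $(c)_r=c(c+1)\cdots(c+r-1)$ is the Pochhammer symbol (rising factorial), with $(c)_0=1$. For an integer $\ell\ge0$ and real $x$, $\binom{x}{\ell}=\frac{x(x-1)\cdots(x-\ell+1)}{\ell!}$. The expansion of $u$ is truncated (a finite sum), with time index $j\ge0$ and spatial (multi-)index $\mathbf{k}$. *)

theory Defs
  imports "HOL-Analysis.Analysis"
begin

text \<open>
  The Jacobi polynomial of DLMF Table 18.3.1: the polynomial of degree \<open>j\<close> that is orthogonal to
  every polynomial of smaller degree for the weight \<open>(1 - x)\<^sup>a (1 + x)\<^sup>b\<close> on \<open>[-1, 1]\<close>,
  scaled to the tabulated leading coefficient.  For \<open>a, b > -1\<close> the weight is integrable, and the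
  description determines the polynomial.  At the end points \<open>0 powr a = 0\<close>, which does not affect
  the integral.
\<close>

definition jacobi_weight :: "real \<Rightarrow> real \<Rightarrow> real \<Rightarrow> real" where
  "jacobi_weight a b x = (1 - x) powr a * (1 + x) powr b"

definition is_jacobi_poly :: "real \<Rightarrow> real \<Rightarrow> nat \<Rightarrow> real poly \<Rightarrow> bool" where
  "is_jacobi_poly a b j p \<longleftrightarrow>
     degree p = j \<and>
     lead_coeff p = pochhammer (real j + a + b + 1) j / (2 ^ j * fact j) \<and>
     (\<forall>q. degree q < j \<longrightarrow>
        ((\<lambda>x. jacobi_weight a b x * poly p x * poly q x) has_integral 0) {-1..1})"

definition jacobi_poly :: "real \<Rightarrow> real \<Rightarrow> nat \<Rightarrow> real poly" where
  "jacobi_poly a b j = (THE p. is_jacobi_poly a b j p)"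

definition block_map :: "real \<Rightarrow> nat \<Rightarrow> real \<Rightarrow> real" where
  "block_map \<Delta>t n t = (2 * t - (2 * real n - 1) * \<Delta>t) / \<Delta>t"

definition shifted_jacobi :: "real \<Rightarrow> real \<Rightarrow> real \<Rightarrow> nat \<Rightarrow> nat \<Rightarrow> real \<Rightarrow> real" where
  "shifted_jacobi a b \<Delta>t n j t = poly (jacobi_poly a b j) (block_map \<Delta>t n t)"

definition endpoint_coeff :: "real \<Rightarrow> real \<Rightarrow> real \<Rightarrow> nat \<Rightarrow> nat \<Rightarrow> real" where
  "endpoint_coeff a b \<Delta>t r j =
     (if j < r then 0
      else \<Delta>t powi (- int r) * pochhammer (real j + a + b + 1) r * ((real j + a) gchoose (j - r)))"

text \<open>
  A family of polynomials, linearly independent as functions on \<open>\<Omega>\<close>; it is a basis of its span.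
  The span is left arbitrary, so that both bases of the space of all polynomials and bases of a
  finite-dimensional space of polynomials are covered.
\<close>

definition polynomial_basis_on ::
    "(real ^ 'm) set \<Rightarrow> 'k set \<Rightarrow> ('k \<Rightarrow> real ^ 'm \<Rightarrow> real) \<Rightarrow> bool" where
  "polynomial_basis_on \<Omega> I q \<longleftrightarrow>
     (\<forall>k\<in>I. real_polynomial_function (q k)) \<and>
     (\<forall>K c. finite K \<longrightarrow> K \<subseteq> I \<longrightarrow> (\<forall>x\<in>\<Omega>. (\<Sum>k\<in>K. c k * q k x) = 0) \<longrightarrow> (\<forall>k\<in>K. c k = 0))"

end

theory Submission
  imports Defs
begin

text \<open>
  The Taylor coefficients of \<open>P\<^sub>j\<close> at the right end point \<open>1\<close> are explicit.  Testing the polynomial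
  with these coefficients against \<open>(1 + x)\<^sup>m\<close> gives a combination of Beta integrals, which up to a
  constant factor is the \<open>j\<close>-th finite difference of a polynomial of degree \<open>j - 1 - m\<close>, hence
  vanishes for \<open>m < j\<close>.  So this polynomial satisfies the orthogonality relations, and these
  determine it because the weight is positive on the open interval.
\<close>

section \<open>Finite differences of Pochhammer polynomials\<close>

text \<open>Pascal's rule rewrites the sum for \<open>Suc n\<close> as the sum for \<open>n\<close>
  of the differences \<open>?g k - ?g (Suc k)\<close>. Each difference lowers the degree
  \<open>d\<close> in \<open>k\<close> by one, so the induction closes.\<close>

lemma alternating_binomial_pochhammer_sum:
  fixes x :: "'a :: comm_ring_1"
  assumes "d < n"
  shows "(\<Sum>k\<le>n. (-1) ^ k * of_nat (n choose k) * pochhammer (x + of_nat k) d) = 0"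
  using assms
proof (induction n arbitrary: x d)
  case (Suc n)
  let ?g = "\<lambda>k. pochhammer (x + of_nat k) d"
  have diff: "?g k - ?g (Suc k) = - of_nat d * pochhammer ((x + 1) + of_nat k) (d - 1)" for k
  proof (cases d)
    case (Suc e)
    have "pochhammer (x + of_nat k) (Suc e) = (x + of_nat k) * pochhammer (x + of_nat k + 1) e"
      by (rule pochhammer_rec)
    moreover have "pochhammer (x + of_nat (Suc k)) (Suc e) =
        pochhammer (x + of_nat k + 1) e * (x + of_nat k + 1 + of_nat e)"
      by (simp add: pochhammer_Suc add_ac)
    ultimately show ?thesis
      by (simp add: Suc algebra_simps)
  qed simp
  have "(\<Sum>k\<le>Suc n. (-1) ^ k * of_nat (Suc n choose k) * ?g k) =
      ?g 0 + (\<Sum>k\<le>n. (-1) ^ Suc k * of_nat (Suc n choose Suc k) * ?g (Suc k))"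
    by (subst sum.atMost_Suc_shift) simp
  also have "\<dots> = (?g 0 + (\<Sum>k\<le>n. (-1) ^ Suc k * of_nat (n choose Suc k) * ?g (Suc k))) -
      (\<Sum>k\<le>n. (-1) ^ k * of_nat (n choose k) * ?g (Suc k))"
    by (simp add: sum.distrib sum_negf sum_subtractf algebra_simps)
  also have "?g 0 + (\<Sum>k\<le>n. (-1) ^ Suc k * of_nat (n choose Suc k) * ?g (Suc k)) =
      (\<Sum>k\<le>Suc n. (-1) ^ k * of_nat (n choose k) * ?g k)"
    by (subst sum.atMost_Suc_shift) (simp add: binomial_eq_0)
  also have "\<dots> = (\<Sum>k\<le>n. (-1) ^ k * of_nat (n choose k) * ?g k)"
    by (simp add: binomial_eq_0)
  also have "\<dots> - (\<Sum>k\<le>n. (-1) ^ k * of_nat (n choose k) * ?g (Suc k)) =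
      (\<Sum>k\<le>n. (-1) ^ k * of_nat (n choose k) * (?g k - ?g (Suc k)))"
    by (simp add: sum_subtractf [symmetric] right_diff_distrib)
  also have "\<dots> = - of_nat d *
      (\<Sum>k\<le>n. (-1) ^ k * of_nat (n choose k) * pochhammer ((x + 1) + of_nat k) (d - 1))"
    unfolding diff sum_distrib_left by (intro sum.cong refl) (simp only: ac_simps)
  also have "\<dots> = 0"
  \<comment> \<open>For \<open>d = 0\<close> the truncated \<open>d - 1\<close> need not be below
    \<open>n\<close>, but then the factor in front is zero.\<close>
  proof (cases "d = 0")
    case False
    with Suc.prems have "d - 1 < n"
      by simp
    from Suc.IH [OF this, of "x + 1"] show ?thesis
      by simp
  qed simp
  finally show ?case .
qed simp

section \<open>Moments of the Jacobi weight as Beta integrals\<close>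

text \<open>The substitution \<open>x = 2 * t - 1\<close> leads to the Beta integral on [0, 1]. The
  four powers contribute the exponent \<open>a + b + r + m\<close> of 2, and
  \<open>dx = 2 dt\<close> adds one more.\<close>

lemma has_integral_jacobi_weight_monomials:
  fixes a b :: real
  assumes "a > -1" and "b > -1"
  shows "((\<lambda>x. jacobi_weight a b x * ((1 - x) ^ r * (1 + x) ^ m)) has_integral
      2 powr (a + b + r + m + 1) * Beta (a + r + 1) (b + m + 1)) {-1..1}"
proof -
  let ?f = "\<lambda>t::real. t powr (b + m) * (1 - t) powr (a + r)"
  let ?c = "2 powr (a + b + r + m) :: real"
  have "(?f has_integral Beta (b + m + 1) (a + r + 1)) (cbox 0 1)"
    using has_integral_Beta_real [of "b + m + 1" "a + r + 1"] assms by simp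
  from has_integral_affinity' [OF this, of "1/2" "1/2"]
  have "((\<lambda>x. ?f (x / 2 + 1 / 2)) has_integral 2 * Beta (b + m + 1) (a + r + 1)) {-1..1}"
    by simp
  from has_integral_mult_right [OF this, of ?c]
  have "((\<lambda>x. ?c * ?f (x / 2 + 1 / 2)) has_integral
      2 powr (a + b + r + m + 1) * Beta (a + r + 1) (b + m + 1)) {-1..1}"
    by (simp add: powr_add Beta_commute [of "b + m + 1"] mult_ac)
  then show ?thesis
  proof (rule has_integral_eq [rotated])
    \<comment> \<open>Since \<open>0 powr c = 0\<close>, these identities also hold at
      \<open>y = 0\<close>, so the integrands agree at the end points as well.\<close>
    have split: "(2 * y) powr (c + k) = 2 powr (c + k) * y powr (c + k) \<and>
        (2 * y) powr c * (2 * y) ^ k = (2 * y) powr (c + k)" if "y \<ge> 0" for y c :: real and k :: nat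
      using that by (cases "y = 0") (auto simp: powr_mult powr_add powr_realpow)
    fix x :: real
    assume x: "x \<in> {-1..1}"
    define t where "t = (1 + x) / 2"
    have t: "0 \<le> t" "0 \<le> 1 - t" "1 + x = 2 * t" "1 - x = 2 * (1 - t)" "x / 2 + 1 / 2 = t"
      using x by (auto simp: t_def field_simps)
    have "jacobi_weight a b x * ((1 - x) ^ r * (1 + x) ^ m) =
        ((2 * (1 - t)) powr a * (2 * (1 - t)) ^ r) * ((2 * t) powr b * (2 * t) ^ m)"
      by (simp only: jacobi_weight_def t mult_ac)
    also have "\<dots> = (2 powr (a + r) * (1 - t) powr (a + r)) * (2 powr (b + m) * t powr (b + m))"
      using split [of "1 - t" a r] split [of t b m] t by metis
    also have "\<dots> = ?c * ?f t"
      by (simp add: powr_add)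
    finally show "?c * ?f (x / 2 + 1 / 2) = jacobi_weight a b x * ((1 - x) ^ r * (1 + x) ^ m)"
      by (simp add: t(5))
  qed
qed


section \<open>Uniqueness of the orthogonal polynomial\<close>

lemma jacobi_weight_pos: "-1 < x \<Longrightarrow> x < 1 \<Longrightarrow> jacobi_weight a b x > 0"
  by (simp add: jacobi_weight_def)

text \<open>The weight may be unbounded near the end points, so the argument moves to [-1/2, 1/2].
  There the integrand is continuous and nonnegative with integral zero, hence zero, and
  \<open>d\<close> has infinitely many roots.\<close>

lemma poly_eq_0_if_jacobi_norm_0:
  assumes "((\<lambda>x. jacobi_weight a b x * poly d x * poly d x) has_integral 0) {-1..1}"
  shows "d = 0"
proof -
  let ?f = "\<lambda>x. jacobi_weight a b x * poly d x * poly d x"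
  have nonneg: "?f x \<ge> 0" for x
    by (simp add: jacobi_weight_def mult.assoc)
  have int: "?f integrable_on {-1..1}"
    using assms by blast
  then have int': "?f integrable_on {-1/2..1/2}"
    by (rule integrable_on_subinterval) auto
  have "integral {-1/2..1/2} ?f \<le> integral {-1..1} ?f"
    using int int' nonneg by (intro integral_subset_le) auto
  then have "integral {-1/2..1/2} ?f = 0"
    using assms nonneg integral_nonneg [OF int'] by (simp add: integral_unique)
  with int' have "(?f has_integral 0) (cbox (-1/2) (1/2))"
    by (metis box_real(2) has_integral_integral)
  moreover have "continuous_on (cbox (-1/2) (1/2)) ?f"
    unfolding jacobi_weight_def by (intro continuous_intros) auto
  ultimately have "?f x = 0" if "x \<in> {-1/2..1/2}" for x
    using has_integral_0_cbox_imp_0 [of "-1/2" "1/2" ?f x] nonneg that by simp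
  then have "poly d x = 0" if "x \<in> {-1/2..1/2}" for x
    using jacobi_weight_pos [of x a b] that by fastforce
  then have "{-1/2..1/2} \<subseteq> {x. poly d x = 0}"
    by blast
  moreover have "infinite {-1/2..1/2::real}"
    by simp
  ultimately show "d = 0"
    using poly_roots_finite finite_subset by blast
qed

text \<open>When \<open>d = p - q\<close> has degree below \<open>j\<close>, it is an admissible
  test polynomial for both \<open>p\<close> and \<open>q\<close>; subtracting the two relations
  shows that its weighted norm is zero.\<close>

lemma is_jacobi_poly_unique:
  assumes "is_jacobi_poly a b j p" and "is_jacobi_poly a b j q"
  shows "p = q"
proof -
  define d where "d = p - q"
  have deg: "degree p = j" "degree q = j" and lead: "coeff p j = coeff q j"
    using assms by (auto simp: is_jacobi_poly_def)
  have "d = 0"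
  proof (cases "degree d < j")
    case True
    with assms have "((\<lambda>x. jacobi_weight a b x * poly p x * poly d x -
        jacobi_weight a b x * poly q x * poly d x) has_integral 0 - 0) {-1..1}"
      by (intro has_integral_diff) (auto simp: is_jacobi_poly_def)
    then have "((\<lambda>x. jacobi_weight a b x * poly d x * poly d x) has_integral 0) {-1..1}"
      by (simp add: d_def algebra_simps)
    then show ?thesis
      by (rule poly_eq_0_if_jacobi_norm_0)
  next
    \<comment> \<open>Equal leading coefficients force \<open>d = 0\<close> here too; this happens
      only for \<open>j = 0\<close>, where there are no test polynomials.\<close>
    case False
    have "degree d \<le> j"
      unfolding d_def using deg by (intro degree_diff_le) auto
    with False have "degree d = j"
      by simp
    moreover have "coeff d j = 0"
      using lead by (simp add: d_def)
    ultimately show ?thesis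
      using leading_coeff_0_iff by metis
  qed
  then show ?thesis
    by (simp add: d_def)
qed

section \<open>The Taylor polynomial at the right end point\<close>

text \<open>The coefficient of \<open>(x - 1) ^ r\<close>, that is, the \<open>r\<close>-th
  derivative at 1 over \<open>fact r\<close>. The power \<open>2 ^ r\<close> will cancel against the
  chain rule factor of \<open>block_map\<close>.\<close>

definition jacobi_taylor_coeff :: "real \<Rightarrow> real \<Rightarrow> nat \<Rightarrow> nat \<Rightarrow> real" where
  "jacobi_taylor_coeff a b j r =
     pochhammer (real j + a + b + 1) r * ((real j + a) gchoose (j - r)) / (fact r * 2 ^ r)"

text \<open>Written in the local variable \<open>x - 1\<close>; composition with
  \<open>[:-1, 1:]\<close> returns to \<open>x\<close>.\<close>

definition jacobi_taylor :: "real \<Rightarrow> real \<Rightarrow> nat \<Rightarrow> real poly" where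
  "jacobi_taylor a b j = (\<Sum>r\<le>j. monom (jacobi_taylor_coeff a b j r) r)"

lemma coeff_jacobi_taylor:
  "coeff (jacobi_taylor a b j) r = (if r \<le> j then jacobi_taylor_coeff a b j r else 0)"
  by (simp add: jacobi_taylor_def coeff_sum sum.delta)

lemma degree_jacobi_taylor:
  assumes "a > -1" and "b > -1"
  shows "degree (jacobi_taylor a b j) = j"
proof (rule antisym)
  show "degree (jacobi_taylor a b j) \<le> j"
    by (rule degree_le) (simp add: coeff_jacobi_taylor)
  have "pochhammer (real j + a + b + 1) j > 0"
  \<comment> \<open>The base \<open>real j + a + b + 1\<close> is positive for \<open>j\<close> at
    least 1. It can be negative for \<open>j = 0\<close>, but then the Pochhammer symbol is
    1.\<close>
  proof (cases "j = 0")
    case False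
    then show ?thesis
      using assms by (intro pochhammer_pos) simp
  qed simp
  then have "coeff (jacobi_taylor a b j) j \<noteq> 0"
    by (simp add: coeff_jacobi_taylor jacobi_taylor_coeff_def)
  then show "j \<le> degree (jacobi_taylor a b j)"
    by (rule le_degree)
qed

text \<open>This isolates the dependence on \<open>r\<close>: \<open>Gamma (a + r + 1)\<close>
  cancels between the binomial and the Beta value, and the Pochhammer quotient becomes a polynomial
  in \<open>r\<close> of degree \<open>j - 1 - m\<close>. The rest is a constant factor.\<close>

lemma jacobi_taylor_moment_term:
  fixes a b :: real
  assumes "a > -1" and "b > -1" and "m < j" and "r \<le> j"
  defines "s \<equiv> a + b + m + 2"
  shows "jacobi_taylor_coeff a b j r * (-1) ^ r *
        (2 powr (a + b + r + m + 1) * Beta (a + r + 1) (b + m + 1)) =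
      2 powr (a + b + m + 1) * Gamma (a + j + 1) * Gamma (b + m + 1) /
        (fact j * pochhammer s (j - 1 - m) * Gamma s) *
      ((-1) ^ r * of_nat (j choose r) * pochhammer (s + of_nat r) (j - 1 - m))"
proof -
  define d where "d = j - 1 - m"
  have s: "s > 0"
    using assms by simp
  have nz: "Gamma (a + r + 1) > 0" "Gamma s > 0"
    using assms s by (auto intro!: Gamma_real_pos)
  have sd: "real j + a + b + 1 = s + d"
    using \<open>m < j\<close> by (simp add: s_def d_def of_nat_diff)
  have "((real j + a) gchoose (j - r)) * Gamma (a + r + 1) = Gamma (a + j + 1) / fact (j - r)"
  proof -
    have pos: "a + r + 1 > 0"
      using assms by simp
    then have "pochhammer (a + r + 1) (j - r) = Gamma (a + r + 1 + of_nat (j - r)) / Gamma (a + r + 1)"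
      by (intro pochhammer_Gamma) (auto elim!: nonpos_Ints_cases)
    moreover have "Gamma (a + r + 1) > 0"
      using pos by (rule Gamma_real_pos)
    ultimately show ?thesis
      using \<open>r \<le> j\<close> by (simp add: gbinomial_pochhammer' of_nat_diff field_simps)
  qed
  then have gb: "((real j + a) gchoose (j - r)) = Gamma (a + j + 1) / (fact (j - r) * Gamma (a + r + 1))"
    using nz(1) by (simp add: field_simps)
  \<comment> \<open>The argument \<open>s + r\<close> is the sum of the two Beta arguments, so this
    is the denominator of the Beta value.\<close>
  have G: "Gamma (s + r) = pochhammer s r * Gamma s"
  proof -
    have "s \<notin> \<int>\<^sub>\<le>\<^sub>0"
      using s by (auto elim!: nonpos_Ints_cases)
    from pochhammer_Gamma [OF this, of r] show ?thesis
      using nz by (simp add: field_simps)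
  qed
  have ps: "pochhammer s k > 0" for k
    using s by (rule pochhammer_pos)
  \<comment> \<open>Here \<open>pochhammer s (r + d)\<close> is split after \<open>d\<close> factors
    and after \<open>r\<close> factors.\<close>
  have P: "pochhammer (s + d) r = pochhammer s r * pochhammer (s + r) d / pochhammer s d"
    using pochhammer_product' [of s d r] pochhammer_product' [of s r d] ps [of d]
    by (simp add: add.commute field_simps)
  have B: "Beta (a + r + 1) (b + m + 1) =
      Gamma (a + r + 1) * Gamma (b + m + 1) / (pochhammer s r * Gamma s)"
    unfolding G [symmetric] by (simp add: Beta_def s_def algebra_simps)
  have C: "real (j choose r) = fact j / (fact r * fact (j - r))"
    using \<open>r \<le> j\<close> by (rule binomial_fact)
  have T: "2 powr (a + b + r + m + 1) = 2 powr (a + b + m + 1) * (2::real) ^ r"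
    by (simp add: powr_add powr_realpow)
  show ?thesis
    unfolding jacobi_taylor_coeff_def sd P gb B C T d_def [symmetric]
    using nz ps [of r] ps [of d] by (simp add: field_simps)
qed

lemma is_jacobi_poly_jacobi_taylor:
  assumes "a > -1" and "b > -1"
  shows "is_jacobi_poly a b j (pcompose (jacobi_taylor a b j) [:-1, 1:])"
  unfolding is_jacobi_poly_def
proof (intro conjI allI impI)
  let ?p = "jacobi_taylor a b j"
  show "degree (pcompose ?p [:-1, 1:]) = j"
    using assms by (simp add: degree_pcompose degree_jacobi_taylor)
  show "lead_coeff (pcompose ?p [:-1, 1:]) = pochhammer (real j + a + b + 1) j / (2 ^ j * fact j)"
    using assms by (subst lead_coeff_comp)
      (simp_all add: degree_jacobi_taylor coeff_jacobi_taylor jacobi_taylor_coeff_def)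
  fix q :: "real poly"
  assume deg: "degree q < j"
  define q' where "q' = pcompose q [:-1, 1:]"
  have deg': "degree q' < j"
    using deg by (simp add: q'_def degree_pcompose)
  \<comment> \<open>Expanding the test polynomial around -1 and the candidate around 1 reduces
    orthogonality to the Beta moments.\<close>
  have q: "poly q x = (\<Sum>m\<le>degree q'. coeff q' m * (1 + x) ^ m)" for x
    using poly_altdef [of q' "1 + x"] by (simp add: q'_def poly_pcompose)
  have p: "poly (pcompose ?p [:-1, 1:]) x =
      (\<Sum>r\<le>j. jacobi_taylor_coeff a b j r * (-1) ^ r * (1 - x) ^ r)" for x
  proof -
    have "poly (pcompose ?p [:-1, 1:]) x = (\<Sum>r\<le>j. jacobi_taylor_coeff a b j r * (x - 1) ^ r)"
      by (simp add: poly_pcompose jacobi_taylor_def poly_sum poly_monom)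
    also have "\<dots> = (\<Sum>r\<le>j. jacobi_taylor_coeff a b j r * (-1) ^ r * (1 - x) ^ r)"
      by (simp add: mult.assoc power_mult_distrib [symmetric])
    finally show ?thesis .
  qed
  let ?I = "\<lambda>r m. 2 powr (a + b + real r + real m + 1) * Beta (a + real r + 1) (b + real m + 1)"
  let ?F = "\<lambda>x. \<Sum>m\<le>degree q'. coeff q' m * (\<Sum>r\<le>j. jacobi_taylor_coeff a b j r * (-1) ^ r *
      (jacobi_weight a b x * ((1 - x) ^ r * (1 + x) ^ m)))"
  have "(?F has_integral (\<Sum>m\<le>degree q'. coeff q' m *
      (\<Sum>r\<le>j. jacobi_taylor_coeff a b j r * (-1) ^ r * ?I r m))) {-1..1}"
    by (intro has_integral_sum has_integral_mult_right has_integral_jacobi_weight_monomials assms) auto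
  also have "(\<Sum>m\<le>degree q'. coeff q' m *
      (\<Sum>r\<le>j. jacobi_taylor_coeff a b j r * (-1) ^ r * ?I r m)) = 0"
  proof (intro sum.neutral ballI)
    fix m
    assume "m \<in> {..degree q'}"
    with deg' have m: "m < j"
      by simp
    \<comment> \<open>Once the constant is pulled out, an alternating sum of order \<open>j\<close>
      over a polynomial of degree \<open>j - 1 - m < j\<close> remains.\<close>
    have "(\<Sum>r\<le>j. jacobi_taylor_coeff a b j r * (-1) ^ r * ?I r m) = 0"
      using m alternating_binomial_pochhammer_sum [of "j - 1 - m" j "a + b + m + 2"]
      by (simp add: jacobi_taylor_moment_term [OF assms m] flip: sum_distrib_left sum_divide_distrib)
    then show "coeff q' m * (\<Sum>r\<le>j. jacobi_taylor_coeff a b j r * (-1) ^ r * ?I r m) = 0"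
      by simp
  qed
  also have "?F = (\<lambda>x. jacobi_weight a b x * poly (pcompose ?p [:-1, 1:]) x * poly q x)"
    unfolding p q by (simp add: sum_distrib_left sum_distrib_right mult_ac) (intro ext sum.swap)
  finally show "((\<lambda>x. jacobi_weight a b x * poly (pcompose ?p [:-1, 1:]) x * poly q x)
      has_integral 0) {-1..1}" .
qed

lemma jacobi_poly_eq:
  assumes "a > -1" and "b > -1"
  shows "jacobi_poly a b j = pcompose (jacobi_taylor a b j) [:-1, 1:]"
  unfolding jacobi_poly_def
  using is_jacobi_poly_jacobi_taylor [OF assms] by (blast intro: is_jacobi_poly_unique)

section \<open>Derivatives at the end point of the block\<close>

lemma higher_pderiv_pcompose_shift:
  "(pderiv ^^ r) (pcompose p [:c, 1:]) = pcompose ((pderiv ^^ r) p) [:c, 1:]"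
  by (induction r) (simp_all add: pderiv_pcompose pderiv_pCons)

text \<open>Since 1 is the centre of the expansion, only the \<open>r\<close>-th Taylor coefficient
  survives, multiplied by \<open>fact r\<close>; it is zero beyond the degree
  \<open>j\<close>.\<close>

lemma higher_pderiv_jacobi_poly_1:
  assumes "a > -1" and "b > -1"
  shows "poly ((pderiv ^^ r) (jacobi_poly a b j)) 1 =
    (if j < r then 0
     else pochhammer (real j + a + b + 1) r * ((real j + a) gchoose (j - r)) / 2 ^ r)"
  by (simp add: jacobi_poly_eq [OF assms] higher_pderiv_pcompose_shift poly_pcompose poly_0_coeff_0
      coeff_higher_pderiv coeff_jacobi_taylor jacobi_taylor_coeff_def
      pochhammer_fact [symmetric])

lemma higher_deriv_poly_block_map:
  "(deriv ^^ r) (\<lambda>t. poly p (block_map h n t)) =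
   (\<lambda>t. (2 / h) ^ r * poly ((pderiv ^^ r) p) (block_map h n t))"
proof (induction r)
  case (Suc r)
  \<comment> \<open>For \<open>h = 0\<close>, division by zero makes the map constantly 0 and
    \<open>2 / h\<close> equal to 0, so the rule still holds.\<close>
  have deriv_block_map: "(block_map h n has_real_derivative 2 / h) (at t)" for t
    unfolding block_map_def [abs_def] by (cases "h = 0") (auto intro!: derivative_eq_intros)
  have "((\<lambda>t. (2 / h) ^ r * poly ((pderiv ^^ r) p) (block_map h n t)) has_real_derivative
      (2 / h) ^ r * (poly (pderiv ((pderiv ^^ r) p)) (block_map h n t) * (2 / h))) (at t)" for t
    using deriv_block_map by (intro DERIV_cmult DERIV_chain' [OF _ poly_DERIV, THEN DERIV_cong]) auto
  then show ?case
    by (auto simp: Suc fun_eq_iff mult_ac intro!: DERIV_imp_deriv)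
qed simp

lemma endpoint_coeff_eq:
  assumes "a > -1" and "b > -1"
  shows "(2 / h) ^ r * poly ((pderiv ^^ r) (jacobi_poly a b j)) 1 = endpoint_coeff a b h r j"
  by (simp add: higher_pderiv_jacobi_poly_1 [OF assms] endpoint_coeff_def power_int_minus
      power_divide field_simps)

theorem lemma3p3:
  fixes \<Delta>t a b :: real and n :: nat
  assumes "\<Delta>t > 0" and "n \<ge> 1" and "a > -1" and "b > -1"
  shows "(\<forall>r j. (deriv ^^ r) (shifted_jacobi a b \<Delta>t n j) (real n * \<Delta>t) = endpoint_coeff a b \<Delta>t r j) \<and>
    (\<forall>(\<Omega> :: (real ^ 'm) set) (I :: 'k set) q (S :: (nat \<times> 'k) set) (U :: nat \<Rightarrow> 'k \<Rightarrow> real) u.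
       polynomial_basis_on \<Omega> I q \<longrightarrow>
       finite S \<longrightarrow> S \<subseteq> UNIV \<times> I \<longrightarrow>
       (\<forall>t. \<forall>x\<in>\<Omega>. u t x = (\<Sum>(j, k)\<in>S. U j k * shifted_jacobi a b \<Delta>t n j t * q k x)) \<longrightarrow>
       (\<forall>r. \<forall>x\<in>\<Omega>. (deriv ^^ r) (\<lambda>t. u t x) (real n * \<Delta>t) =
          (\<Sum>k\<in>snd ` S. (\<Sum>j | (j, k) \<in> S. endpoint_coeff a b \<Delta>t r j * U j k) * q k x)))"
proof (intro conjI allI impI ballI)
  have final_slice: "block_map \<Delta>t n (real n * \<Delta>t) = 1"
    using assms by (simp add: block_map_def field_simps)
  {
    fix r j
    show "(deriv ^^ r) (shifted_jacobi a b \<Delta>t n j) (real n * \<Delta>t) = endpoint_coeff a b \<Delta>t r j"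
      unfolding shifted_jacobi_def
      by (simp add: higher_deriv_poly_block_map final_slice endpoint_coeff_eq assms)
  }
  fix \<Omega> :: "(real ^ 'm) set" and I :: "'k set" and q and S :: "(nat \<times> 'k) set"
    and U :: "nat \<Rightarrow> 'k \<Rightarrow> real" and u r x
  assume fin: "finite S" and x: "x \<in> \<Omega>"
    and u: "\<forall>t. \<forall>x\<in>\<Omega>. u t x = (\<Sum>(j, k)\<in>S. U j k * shifted_jacobi a b \<Delta>t n j t * q k x)"
  \<comment> \<open>For fixed \<open>x\<close>, \<open>u\<close> is a single polynomial in the block
    variable, so linearity of \<open>deriv\<close> reduces to that of \<open>pderiv\<close>.\<close>
  define p where "p = (\<Sum>(j, k)\<in>S. smult (U j k * q k x) (jacobi_poly a b j))"
  have "(\<lambda>t. u t x) = (\<lambda>t. poly p (block_map \<Delta>t n t))"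
    using u x by (auto simp: p_def poly_sum shifted_jacobi_def fun_eq_iff case_prod_unfold mult_ac)
  then have "(deriv ^^ r) (\<lambda>t. u t x) (real n * \<Delta>t) = (2 / \<Delta>t) ^ r * poly ((pderiv ^^ r) p) 1"
    by (simp add: higher_deriv_poly_block_map final_slice)
  also have "\<dots> = (\<Sum>(j, k)\<in>S. (2 / \<Delta>t) ^ r *
      poly ((pderiv ^^ r) (jacobi_poly a b j)) 1 * U j k * q k x)"
    by (simp add: p_def higher_pderiv_sum higher_pderiv_smult poly_sum sum_distrib_left
        case_prod_unfold mult_ac)
  also have "\<dots> = (\<Sum>(j, k)\<in>S. endpoint_coeff a b \<Delta>t r j * U j k * q k x)"
    by (simp only: endpoint_coeff_eq assms)
  \<comment> \<open>The pairs in \<open>S\<close> are grouped by their spatial index;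
    \<open>S\<close> need not be a product set.\<close>
  also have "\<dots> = (\<Sum>k\<in>snd ` S. \<Sum>z\<in>{z \<in> S. snd z = k}. endpoint_coeff a b \<Delta>t r (fst z) *
      U (fst z) (snd z) * q (snd z) x)"
    using fin by (simp add: sum.image_gen [of S _ snd] case_prod_unfold)
  also have "\<dots> = (\<Sum>k\<in>snd ` S. (\<Sum>j | (j, k) \<in> S. endpoint_coeff a b \<Delta>t r j * U j k) * q k x)"
  proof (rule sum.cong [OF refl])
    fix k
    have "(\<Sum>z\<in>{z \<in> S. snd z = k}. endpoint_coeff a b \<Delta>t r (fst z) * U (fst z) (snd z) * q (snd z) x) =
        (\<Sum>j | (j, k) \<in> S. endpoint_coeff a b \<Delta>t r j * U j k * q k x)"
      by (rule sum.reindex_bij_witness [where i = "\<lambda>j. (j, k)" and j = fst]) auto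
    then show "(\<Sum>z\<in>{z \<in> S. snd z = k}. endpoint_coeff a b \<Delta>t r (fst z) * U (fst z) (snd z) * q (snd z) x) =
        (\<Sum>j | (j, k) \<in> S. endpoint_coeff a b \<Delta>t r j * U j k) * q k x"
      by (simp add: sum_distrib_right)
  qed
  finally show "(deriv ^^ r) (\<lambda>t. u t x) (real n * \<Delta>t) =
      (\<Sum>k\<in>snd ` S. (\<Sum>j | (j, k) \<in> S. endpoint_coeff a b \<Delta>t r j * U j k) * q k x)" .
qed

end
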